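(* Let $X$ be a Banach space, $(A_n)_{n\in\mathbb N}$ a sequence in $\mathcal B(X)$, $\mu=(\mu_n)_{n\in\mathbb N}$ a growth rate and $\nu=(\nu_n)_{n\in\mathbb N}$ a sequence with $\nu_n\ge 1$ for all $n$. Suppose that there exist a closed subspace $Z\subset X$ and $\beta>0$ such that: (1) for each $\mathbf y=(y_n)_{n\in\mathbb N}\in\ell^1_{\beta,0}$ there exists a unique $\mathbf x=(x_n)_{n\in\mathbb N}\in\ell^\infty_{\beta,Z}$ such that $x_{n+1}-A_nx_n=y_{n+1}$ for all $n\in\mathbb N$; (2) for each $\mathbf y=(y_n)_{n\in\mathbb N}\in\ell^1_{-\beta,0}$ there exists a unique $\mathbf x=(x_n)_{n\in\mathbb N}\in\ell^\infty_{-\beta,Z}$ such that $x_{n+1}-A_nx_n=y_{n+1}$ for all $n\in\mathbb N$. Then $(A_n)_{n\in\mathbb N}$ admits a $(\mu,\nu)$-dichotomy.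
   Context: $\mathbb N=\{0,1,2,\dots\}$. $(X,\|\cdot\|)$ is a Banach space and $\mathcal B(X)$ is the space of bounded linear operators on $X$ with the operator norm. A growth rate $\mu=(\mu_n)_{n\in\mathbb N}$ is a strictly increasing sequence of positive numbers with $\lim_{n\to+\infty}\mu_n=+\infty$. For $m\ge n$, $\mathcal A(m,n)=A_{m-1}\cdots A_n$ if $m>n$ and $\mathcal A(n,n)=\mathrm{Id}$. $(\mu,\nu)$-dichotomy: $(A_n)_{n\in\mathbb N}$ admits a $(\mu,\nu)$-dichotomy if (1) there are projections $P_n$ on $X$, $n\in\mathbb N$, with $A_nP_n=P_{n+1}A_n$ for all $n$; (2) $A_n|_{\operatorname{Ker}P_n}:\operatorname{Ker}P_n\to\operatorname{Ker}P_{n+1}$ is invertible for all $n$; (3) there exist $D,\lambda>0$ such that $\|\mathcal A(m,n)P_n\|\le D\nu_n(\mu_m/\mu_n)^{-\lambda}$ for $m\ge n$ and $\|\mathcal A(m,n)(\mathrm{Id}-P_n)\|\le D\nu_n(\mu_n/\mu_m)^{-\lambda}$ for $m\le n$, where for $m\le n$ one sets $\mathcal A(m,n):=(\mathcal A(n,m)|_{\operatorname{Ker}P_m})^{-1}:\operatorname{Ker}P_n\to\operatorname{Ker}P_m$. Weighted spaces: for $\beta\in\mathbb R$, $\ell^\infty_\beta$ is the Banach space of sequences $\mathbf x=(x_n)_{n\in\mathbb N}\subset X$ with $\|\mathbf x\|_{\infty,\beta}:=\sup_{n}\mu_n^\beta\|x_n\|<+\infty$, and $\ell^1_\beta$ is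 the Banach space of sequences with $\|\mathbf x\|_{1,\beta}:=\sum_{n}\mu_n^\beta\nu_n\|x_n\|<+\infty$. For a closed subspace $Z\subset X$, $\ell^\infty_{\beta,Z}:=\{\mathbf x\in\ell^\infty_\beta: x_0\in Z\}$, and $\ell^1_{\beta,0}:=\{\mathbf x\in\ell^1_\beta: x_0=0\}$. *)

theory Defs
  imports "HOL-Analysis.Analysis"
begin

definition growth_rate :: "(nat \<Rightarrow> real) \<Rightarrow> bool" where
  "growth_rate \<mu> \<longleftrightarrow>
     strict_mono \<mu> \<and> (\<forall>n. 0 < \<mu> n) \<and> filterlim \<mu> at_top sequentially"

(* A(m,n) = A_(m-1) ... A_n for m > n and A(n,n) = Id; the value for m < n is
   irrelevant, see backward_transition. *)
primrec transition ::
  "(nat \<Rightarrow> 'a::real_normed_vector \<Rightarrow>\<^sub>L 'a) \<Rightarrow> nat \<Rightarrow> nat \<Rightarrow> 'a \<Rightarrow>\<^sub>L 'a" where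
  "transition A 0 n = id_blinfun"
| "transition A (Suc m) n =
     (if n \<le> m then A m o\<^sub>L transition A m n else id_blinfun)"

lemma transition_same [simp]: "transition A n n = id_blinfun"
  by (cases n) auto

definition ker_blinfun :: "('a::real_normed_vector \<Rightarrow>\<^sub>L 'b::real_normed_vector) \<Rightarrow> 'a set" where
  "ker_blinfun T = {v. blinfun_apply T v = 0}"

(* For m \<le> n: the inverse of A(n,m) restricted to Ker P_m. Only its values on
   Ker P_n, where it is a genuine inverse by the bijectivity in dichotomy, are used. *)
definition backward_transition ::
  "(nat \<Rightarrow> 'a::real_normed_vector \<Rightarrow>\<^sub>L 'a) \<Rightarrow> (nat \<Rightarrow> 'a \<Rightarrow>\<^sub>L 'a) \<Rightarrow> nat \<Rightarrow> nat \<Rightarrow> 'a \<Rightarrow> 'a" where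
  "backward_transition A P m n =
     inv_into (ker_blinfun (P m)) (blinfun_apply (transition A n m))"

(* onorm is meaningful only for bounded operators, hence the bounded_linear conjunct
   accompanying the second estimate. *)
definition dichotomy ::
  "(nat \<Rightarrow> real) \<Rightarrow> (nat \<Rightarrow> real) \<Rightarrow> (nat \<Rightarrow> 'a::real_normed_vector \<Rightarrow>\<^sub>L 'a) \<Rightarrow> bool" where
  "dichotomy \<mu> \<nu> A \<longleftrightarrow>
    (\<exists>P :: nat \<Rightarrow> 'a \<Rightarrow>\<^sub>L 'a.
       (\<forall>n. P n o\<^sub>L P n = P n) \<and>
       (\<forall>n. A n o\<^sub>L P n = P (Suc n) o\<^sub>L A n) \<and>
       (\<forall>n. bij_betw (blinfun_apply (A n)) (ker_blinfun (P n)) (ker_blinfun (P (Suc n)))) \<and>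
       (\<exists>(D :: real) (a :: real). 0 < D \<and> 0 < a \<and>
          (\<forall>m n. n \<le> m \<longrightarrow>
             norm (transition A m n o\<^sub>L P n) \<le> D * \<nu> n * (\<mu> m / \<mu> n) powr (- a)) \<and>
          (\<forall>m n. m \<le> n \<longrightarrow>
             bounded_linear (\<lambda>v. backward_transition A P m n (v - P n v)) \<and>
             onorm (\<lambda>v. backward_transition A P m n (v - P n v))
               \<le> D * \<nu> n * (\<mu> n / \<mu> m) powr (- a))))"

definition linf_weighted ::
  "(nat \<Rightarrow> real) \<Rightarrow> real \<Rightarrow> (nat \<Rightarrow> 'a::real_normed_vector) set" where
  "linf_weighted \<mu> \<beta> = {x. bdd_above (range (\<lambda>n. \<mu> n powr \<beta> * norm (x n)))}"

definition l1_weighted ::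
  "(nat \<Rightarrow> real) \<Rightarrow> (nat \<Rightarrow> real) \<Rightarrow> real \<Rightarrow> (nat \<Rightarrow> 'a::real_normed_vector) set" where
  "l1_weighted \<mu> \<nu> \<beta> = {x. summable (\<lambda>n. \<mu> n powr \<beta> * \<nu> n * norm (x n))}"

definition linf_weighted_init ::
  "(nat \<Rightarrow> real) \<Rightarrow> real \<Rightarrow> 'a::real_normed_vector set \<Rightarrow> (nat \<Rightarrow> 'a) set" where
  "linf_weighted_init \<mu> \<beta> Z = {x \<in> linf_weighted \<mu> \<beta>. x 0 \<in> Z}"

definition l1_weighted_0 ::
  "(nat \<Rightarrow> real) \<Rightarrow> (nat \<Rightarrow> real) \<Rightarrow> real \<Rightarrow> (nat \<Rightarrow> 'a::real_normed_vector) set" where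
  "l1_weighted_0 \<mu> \<nu> \<beta> = {x \<in> l1_weighted \<mu> \<nu> \<beta>. x 0 = 0}"

end

theory Submission
  imports Defs "HOL-Probability.Discrete_Topology"
begin

text \<open>By uniqueness, a bounded solution whose right-hand side is a single impulse is the same for
  both weights. By the closed graph theorem the solution operator is bounded for each weight, and
  hence the solution is bounded in both weighted norms, uniformly in the position \<open>n\<close> of the
  impulse. One bound gives the decay forward of \<open>n\<close>, the other the decay backward of \<open>n\<close>. The value
  at time \<open>n\<close> of the solution with impulse \<open>v\<close> is the projection of \<open>v\<close> along the image of \<open>Z\<close> at
  time \<open>n\<close>; the algebraic properties of these projections follow from uniqueness by exhibiting
  solutions.\<close>

subsection \<open>The closed graph theorem\<close>

lemma UN_eq_UNIV_imp_interior_closure_nonempty: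
  fixes F :: "nat \<Rightarrow> 'a::complete_space set"
  assumes "(\<Union>n. F n) = UNIV"
  shows "\<exists>n. interior (closure (F n)) \<noteq> {}"
proof (rule ccontr)
  assume nowhere_dense: "\<not> ?thesis"
  have "Met_TC.mtopology interior_of \<Union>(range (\<lambda>n. closure (F n))) = {}"
  proof (rule Met_TC.metric_Baire_category_alt)
    show "Met_TC.mcomplete TYPE('a)" by (simp add: complete_UNIV)
    show "closedin Met_TC.mtopology S \<and> Met_TC.mtopology interior_of S = {}"
      if "S \<in> range (\<lambda>n. closure (F n))" for S
      using nowhere_dense that by auto
  qed simp
  moreover have "(\<Union>n. closure (F n)) = UNIV"
    using assms closure_subset by blast
  ultimately show False by simp
qed

lemma linear_approx_in_ball_by_bounded_images:
  fixes T :: "'a::banach \<Rightarrow> 'b::real_normed_vector"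
  assumes "linear T"
  obtains r M where "0 < r"
    "\<forall>z e. norm z < r \<longrightarrow> 0 < e \<longrightarrow> (\<exists>a. norm (T a) \<le> M \<and> norm (z - a) < e)"
proof -
  have "(\<Union>n. {x. norm (T x) \<le> real n}) = UNIV"
    using real_arch_simple by auto
  then obtain n x0 where "x0 \<in> interior (closure {x. norm (T x) \<le> real n})"
    using UN_eq_UNIV_imp_interior_closure_nonempty by blast
  then obtain r where r: "0 < r" "ball x0 r \<subseteq> closure {x. norm (T x) \<le> real n}"
    unfolding mem_interior by blast
  have "\<exists>a. norm (T a) \<le> 2 * real n \<and> norm (z - a) < e" if "norm z < r" "0 < e" for z e
  proof -
    have "x0 + z \<in> closure {x. norm (T x) \<le> real n}" "x0 \<in> closure {x. norm (T x) \<le> real n}"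
      using r that by (auto simp: subset_iff dist_norm)
    then obtain a b where a: "norm (T a) \<le> real n" "dist a (x0 + z) < e / 2"
      and b: "norm (T b) \<le> real n" "dist b x0 < e / 2"
      using half_gt_zero[OF \<open>0 < e\<close>] unfolding closure_approachable by blast
    have "norm (T (a - b)) \<le> 2 * real n"
      using norm_triangle_ineq4[of "T a" "T b"] a b by (simp add: linear_diff[OF \<open>linear T\<close>])
    moreover have "norm (z - (a - b)) \<le> norm (b - x0) + norm (a - (x0 + z))"
      using norm_triangle_ineq4[of "b - x0" "a - (x0 + z)"] by (simp add: algebra_simps)
    ultimately show ?thesis
      using a b by (intro exI[of _ "a - b"]) (auto simp: dist_norm)
  qed
  then show thesis
    by (intro that[OF r(1), of "2 * real n"]) simp
qed

lemma linear_approx_by_bounded_images: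
  fixes T :: "'a::banach \<Rightarrow> 'b::real_normed_vector"
  assumes "linear T"
  shows "\<exists>K\<ge>0. \<forall>z e. 0 < e \<longrightarrow> (\<exists>a. norm (T a) \<le> K * norm z \<and> norm (z - a) < e)"
proof -
  obtain r M where r: "0 < r"
    and M: "\<And>z e. norm z < r \<Longrightarrow> 0 < e \<Longrightarrow> \<exists>a. norm (T a) \<le> M \<and> norm (z - a) < e"
    using linear_approx_in_ball_by_bounded_images[OF assms] by metis
  have "0 \<le> M"
    using M[of 0 1] r order_trans[OF norm_ge_zero] by auto
  have "\<exists>a. norm (T a) \<le> 2 * M / r * norm z \<and> norm (z - a) < e" if "0 < e" for z e
  proof (cases "z = 0")
    case True
    then show ?thesis
      using \<open>0 < e\<close> by (intro exI[of _ 0]) (simp add: linear_0[OF assms])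
  next
    case False
    define t where "t = r / (2 * norm z)"
    have t: "0 < t" using r False by (simp add: t_def)
    have "norm (t *\<^sub>R z) < r" using r False by (simp add: t_def)
    then obtain a where a: "norm (T a) \<le> M" "norm (t *\<^sub>R z - a) < t * e"
      using M t \<open>0 < e\<close> by (meson mult_pos_pos)
    have "norm (T (a /\<^sub>R t)) \<le> 2 * M / r * norm z"
      using a t r False by (simp add: linear_scale[OF assms] t_def field_simps)
    moreover have "z - a /\<^sub>R t = (t *\<^sub>R z - a) /\<^sub>R t"
      using t by (simp add: scaleR_right_diff_distrib)
    then have "norm (z - a /\<^sub>R t) = norm (t *\<^sub>R z - a) / t"
      using t by (simp only: norm_scaleR) (simp add: divide_inverse)
    then have "norm (z - a /\<^sub>R t) < e"
      using a t by (simp add: pos_divide_less_eq mult.commute)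
    ultimately show ?thesis by blast
  qed
  then show ?thesis
    using r \<open>0 \<le> M\<close> by (intro exI[of _ "2 * M / r"]) simp
qed

lemma series_with_bounded_images:
  fixes T :: "'a::real_normed_vector \<Rightarrow> 'b::real_normed_vector"
  assumes approx: "\<And>x e. 0 < e \<Longrightarrow> \<exists>a. norm (T a) \<le> K * norm x \<and> norm (x - a) < e"
    and "0 \<le> K" "z \<noteq> 0"
  obtains a where "a sums z" "\<And>k. norm (T (a k)) \<le> K * norm z * (1 / 2) ^ k"
proof -
  have "\<exists>f. \<forall>k. (norm (f k) \<le> norm z * (1 / 2) ^ k \<and> (k = 0 \<longrightarrow> f k = z)) \<and>
      norm (T (f k - f (Suc k))) \<le> K * norm z * (1 / 2) ^ k"
  proof (rule dependent_nat_choice)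
    fix x and k :: nat
    assume x: "norm x \<le> norm z * (1 / 2) ^ k \<and> (k = 0 \<longrightarrow> x = z)"
    obtain a where a: "norm (T a) \<le> K * norm x" "norm (x - a) < norm z * (1 / 2) ^ Suc k"
      using approx[of "norm z * (1 / 2) ^ Suc k" x] \<open>z \<noteq> 0\<close> by auto
    have "K * norm x \<le> K * norm z * (1 / 2) ^ k"
      using mult_left_mono[OF conjunct1[OF x] \<open>0 \<le> K\<close>] by (simp add: mult.assoc)
    with a show "\<exists>y. (norm y \<le> norm z * (1 / 2) ^ Suc k \<and> (Suc k = 0 \<longrightarrow> y = z)) \<and>
        norm (T (x - y)) \<le> K * norm z * (1 / 2) ^ k"
      by (intro exI[of _ "x - a"]) auto
  qed auto
  then obtain f where f: "\<And>k. norm (f k) \<le> norm z * (1 / 2) ^ k" "f 0 = z"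
    "\<And>k. norm (T (f k - f (Suc k))) \<le> K * norm z * (1 / 2) ^ k"
    by auto
  have "(\<lambda>k. norm z * (1 / 2) ^ k) \<longlonglongrightarrow> 0"
    by (intro tendsto_mult_right_zero LIMSEQ_realpow_zero) auto
  then have "f \<longlonglongrightarrow> 0"
    by (rule Lim_null_comparison[rotated]) (simp add: f)
  then have "(\<lambda>k. f k - f (Suc k)) sums z"
    using telescope_sums'[of f 0] f(2) by simp
  then show thesis using f(3) by (rule that)
qed

theorem closed_graph_theorem:
  fixes T :: "'a::banach \<Rightarrow> 'b::banach"
  assumes "linear T"
    and closed_graph: "\<And>X x y. X \<longlonglongrightarrow> x \<Longrightarrow> (\<lambda>n. T (X n)) \<longlonglongrightarrow> y \<Longrightarrow> T x = y"
  shows "bounded_linear T"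
proof -
  interpret T: linear T by fact
  obtain K where K: "0 \<le> K" "\<And>x e. 0 < e \<Longrightarrow> \<exists>a. norm (T a) \<le> K * norm x \<and> norm (x - a) < e"
    using linear_approx_by_bounded_images[OF \<open>linear T\<close>] by auto
  have "norm (T z) \<le> norm z * (2 * K)" for z
  proof (cases "z = 0")
    case False
    obtain a where a: "a sums z" "\<And>k. norm (T (a k)) \<le> K * norm z * (1 / 2) ^ k"
      using series_with_bounded_images[OF K(2,1) False] by blast
    have geometric: "summable (\<lambda>k. K * norm z * (1 / 2) ^ k)"
      by (intro summable_mult summable_geometric) simp
    then have summable_norm_T: "summable (\<lambda>k. norm (T (a k)))"
      by (rule summable_comparison_test'[of _ 0]) (simp add: a)
    have "(\<lambda>n. \<Sum>k<n. T (a k)) \<longlonglongrightarrow> (\<Sum>k. T (a k))"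
      by (rule summable_LIMSEQ[OF summable_norm_cancel[OF summable_norm_T]])
    then have "T z = (\<Sum>k. T (a k))"
      using a(1) by (intro closed_graph[of "\<lambda>n. \<Sum>k<n. a k"]) (simp_all add: sums_def T.sum)
    then have "norm (T z) = norm (\<Sum>k. T (a k))" by simp
    also have "\<dots> \<le> (\<Sum>k. norm (T (a k)))"
      by (rule summable_norm[OF summable_norm_T])
    also have "\<dots> \<le> (\<Sum>k. K * norm z * (1 / 2) ^ k)"
      by (intro suminf_le a summable_norm_T geometric)
    also have "\<dots> = norm z * (2 * K)"
      by (simp add: suminf_mult suminf_geometric)
    finally show ?thesis .
  qed simp
  then show ?thesis
    by (intro bounded_linear_intro[of T "2 * K"] T.add T.scaleR)
qed

subsection \<open>The Banach space of absolutely summable sequences\<close>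

lemma summable_norm_add:
  fixes x y :: "nat \<Rightarrow> 'a::real_normed_vector"
  assumes "summable (\<lambda>n. norm (x n))" "summable (\<lambda>n. norm (y n))"
  shows "summable (\<lambda>n. norm (x n + y n))"
  by (rule summable_comparison_test'[OF summable_add[OF assms], of 0])
    (simp add: norm_triangle_ineq)

typedef (overloaded) 'a l1 =
  "{x :: nat \<Rightarrow> 'a::real_normed_vector. summable (\<lambda>n. norm (x n))}"
  morphisms l1_nth Abs_l1
  by (rule exI[of _ "\<lambda>_. 0"]) simp

setup_lifting type_definition_l1

lemma summable_norm_l1_nth: "summable (\<lambda>n. norm (l1_nth x n))"
  using l1_nth by blast

instantiation l1 :: (real_normed_vector) real_normed_vector
begin

lift_definition zero_l1 :: "'a l1" is "\<lambda>_. 0" by simp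

lift_definition plus_l1 :: "'a l1 \<Rightarrow> 'a l1 \<Rightarrow> 'a l1" is "\<lambda>x y n. x n + y n"
  by (rule summable_norm_add)

lift_definition uminus_l1 :: "'a l1 \<Rightarrow> 'a l1" is "\<lambda>x n. - x n" by simp

lift_definition minus_l1 :: "'a l1 \<Rightarrow> 'a l1 \<Rightarrow> 'a l1" is "\<lambda>x y n. x n - y n"
  using summable_norm_add[of _ "\<lambda>n. - y n" for y] by simp

lift_definition scaleR_l1 :: "real \<Rightarrow> 'a l1 \<Rightarrow> 'a l1" is "\<lambda>c x n. c *\<^sub>R x n"
  by (simp add: summable_mult)

lift_definition norm_l1 :: "'a l1 \<Rightarrow> real" is "\<lambda>x. \<Sum>n. norm (x n)" .

definition sgn_l1 :: "'a l1 \<Rightarrow> 'a l1" where "sgn_l1 x = inverse (norm x) *\<^sub>R x"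

definition dist_l1 :: "'a l1 \<Rightarrow> 'a l1 \<Rightarrow> real" where "dist_l1 x y = norm (x - y)"

definition uniformity_l1 :: "('a l1 \<times> 'a l1) filter" where
  "uniformity_l1 = (INF e\<in>{0 <..}. principal {(x, y). dist x y < e})"

definition open_l1 :: "'a l1 set \<Rightarrow> bool" where
  "open_l1 S = (\<forall>x\<in>S. \<forall>\<^sub>F (x', y) in uniformity. x' = x \<longrightarrow> y \<in> S)"

instance
proof
  fix x y z :: "'a l1" and c d :: real
  show "x + y + z = x + (y + z)" "x + y = y + x"
    by (transfer; simp add: ac_simps)+
  show "0 + x = x" "- x + x = 0" "x - y = x + - y"
    by (transfer; simp)+
  show "c *\<^sub>R (x + y) = c *\<^sub>R x + c *\<^sub>R y" "(c + d) *\<^sub>R x = c *\<^sub>R x + d *\<^sub>R x"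
    "c *\<^sub>R d *\<^sub>R x = (c * d) *\<^sub>R x" "1 *\<^sub>R x = x"
    by (transfer; simp add: scaleR_add_right scaleR_add_left)+
  show "norm x = 0 \<longleftrightarrow> x = 0"
    by transfer (auto simp: suminf_eq_zero_iff)
  show "norm (c *\<^sub>R x) = \<bar>c\<bar> * norm x"
    by transfer (simp add: suminf_mult)
  show "norm (x + y) \<le> norm x + norm y"
  proof transfer
    fix x y :: "nat \<Rightarrow> 'a"
    assume xy: "summable (\<lambda>n. norm (x n))" "summable (\<lambda>n. norm (y n))"
    then have "(\<Sum>n. norm (x n + y n)) \<le> (\<Sum>n. norm (x n) + norm (y n))"
      by (intro suminf_le norm_triangle_ineq summable_add summable_norm_add)
    also have "\<dots> = (\<Sum>n. norm (x n)) + (\<Sum>n. norm (y n))"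
      using xy by (simp add: suminf_add)
    finally show "(\<Sum>n. norm (x n + y n)) \<le> (\<Sum>n. norm (x n)) + (\<Sum>n. norm (y n))" .
  qed
qed (simp_all add: sgn_l1_def dist_l1_def uniformity_l1_def open_l1_def)

end

lemma sum_norm_l1_nth_le: "(\<Sum>n<N. norm (l1_nth x n)) \<le> norm x"
  unfolding norm_l1.rep_eq by (rule sum_le_suminf[OF summable_norm_l1_nth]) auto

lemma norm_l1_nth_le: "norm (l1_nth x n) \<le> norm x"
  unfolding norm_l1.rep_eq using sum_le_suminf[OF summable_norm_l1_nth, of "{n}" x] by simp

lemma bounded_linear_l1_nth: "bounded_linear (\<lambda>x. l1_nth x n)"
  by (rule bounded_linear_intro[of _ 1])
    (simp_all add: plus_l1.rep_eq scaleR_l1.rep_eq norm_l1_nth_le)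

lemma Cauchy_l1_partial_sums:
  fixes X :: "nat \<Rightarrow> 'a::real_normed_vector l1"
  assumes "Cauchy X" and limit: "\<And>n. (\<lambda>i. l1_nth (X i) n) \<longlonglongrightarrow> x n" and "0 < e"
  obtains M where "\<And>i N. M \<le> i \<Longrightarrow> (\<Sum>n<N. norm (l1_nth (X i) n - x n)) \<le> e"
proof -
  obtain M where M: "\<And>i j. M \<le> i \<Longrightarrow> M \<le> j \<Longrightarrow> norm (X i - X j) < e"
    using CauchyD[OF \<open>Cauchy X\<close> \<open>0 < e\<close>] by blast
  have "(\<Sum>n<N. norm (l1_nth (X i) n - x n)) \<le> e" if "M \<le> i" for i N
  proof (rule tendsto_upperbound)
    show "(\<lambda>j. \<Sum>n<N. norm (l1_nth (X i) n - l1_nth (X j) n))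
        \<longlonglongrightarrow> (\<Sum>n<N. norm (l1_nth (X i) n - x n))"
      by (intro tendsto_intros limit)
    have "(\<Sum>n<N. norm (l1_nth (X i) n - l1_nth (X j) n)) \<le> e" if "M \<le> j" for j
      using sum_norm_l1_nth_le[of "X i - X j" N] M[OF \<open>M \<le> i\<close> that] by (simp add: minus_l1.rep_eq)
    then show "\<forall>\<^sub>F j in sequentially. (\<Sum>n<N. norm (l1_nth (X i) n - l1_nth (X j) n)) \<le> e"
      by (auto simp: eventually_sequentially)
  qed simp
  then show thesis by (rule that)
qed

lemma Cauchy_l1_coordinatewise_imp_convergent:
  fixes X :: "nat \<Rightarrow> 'a::real_normed_vector l1"
  assumes "Cauchy X" and limit: "\<And>n. (\<lambda>i. l1_nth (X i) n) \<longlonglongrightarrow> x n"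
  shows "convergent X"
proof -
  have summable_diff: "summable (\<lambda>n. norm (l1_nth (X i) n - x n))"
    if "\<And>N. (\<Sum>n<N. norm (l1_nth (X i) n - x n)) \<le> e" for i e
    using that by (intro summableI_nonneg_bounded[of _ e]) auto
  obtain M where M: "\<And>i N. M \<le> i \<Longrightarrow> (\<Sum>n<N. norm (l1_nth (X i) n - x n)) \<le> 1"
    using Cauchy_l1_partial_sums[OF assms zero_less_one] by blast
  have "summable (\<lambda>n. norm (l1_nth (X M) n - x n))"
    by (rule summable_diff[OF M[OF order_refl]])
  then have "summable (\<lambda>n. norm (l1_nth (X M) n + (x n - l1_nth (X M) n)))"
    by (intro summable_norm_add summable_norm_l1_nth) (simp add: norm_minus_commute)
  then have nth_x: "l1_nth (Abs_l1 x) = x" by (simp add: Abs_l1_inverse)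
  have "X \<longlonglongrightarrow> Abs_l1 x"
  proof (rule LIMSEQ_I)
    fix e :: real assume "0 < e"
    obtain M where M: "\<And>i N. M \<le> i \<Longrightarrow> (\<Sum>n<N. norm (l1_nth (X i) n - x n)) \<le> e / 2"
      using Cauchy_l1_partial_sums[OF assms half_gt_zero[OF \<open>0 < e\<close>]] by blast
    have "norm (X i - Abs_l1 x) < e" if "M \<le> i" for i
    proof -
      have "norm (X i - Abs_l1 x) \<le> e / 2"
        unfolding norm_l1.rep_eq minus_l1.rep_eq nth_x
        by (rule suminf_le_const[OF summable_diff[OF M[OF that]] M[OF that]])
      also have "\<dots> < e" using \<open>0 < e\<close> by simp
      finally show ?thesis .
    qed
    then show "\<exists>M. \<forall>i\<ge>M. norm (X i - Abs_l1 x) < e" by blast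
  qed
  then show ?thesis by (rule convergentI)
qed

instance l1 :: (banach) banach
proof
  fix X :: "nat \<Rightarrow> 'a l1" assume "Cauchy X"
  then have "convergent (\<lambda>i. l1_nth (X i) n)" for n
    using bounded_linear.Cauchy[OF bounded_linear_l1_nth] Cauchy_convergent by blast
  then show "convergent X"
    by (intro Cauchy_l1_coordinatewise_imp_convergent[OF \<open>Cauchy X\<close>])
      (rule convergent_LIMSEQ_iff[THEN iffD1])
qed

instance bcontfun :: (metric_space, banach) banach ..

subsection \<open>Bounded solutions of the inhomogeneous equation\<close>

text \<open>The initial value \<open>y 0\<close> shifts the subspace \<open>Z\<close>: this treats an impulse at time 0 like all
  other impulses.\<close>

definition bounded_solution ::
  "(nat \<Rightarrow> 'a::real_normed_vector \<Rightarrow>\<^sub>L 'a) \<Rightarrow> (nat \<Rightarrow> real) \<Rightarrow> 'a set \<Rightarrow> (nat \<Rightarrow> 'a) \<Rightarrow> (nat \<Rightarrow> 'a) \<Rightarrow> bool"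
  where "bounded_solution A a Z y x \<longleftrightarrow>
    bounded (range (\<lambda>n. a n *\<^sub>R x n)) \<and> x 0 - y 0 \<in> Z \<and> (\<forall>n. x (Suc n) - A n (x n) = y (Suc n))"

lemma bounded_solution_add:
  assumes "subspace Z" "bounded_solution A a Z y x" "bounded_solution A a Z y' x'"
  shows "bounded_solution A a Z (\<lambda>n. y n + y' n) (\<lambda>n. x n + x' n)"
proof -
  have "bounded (range (\<lambda>n. a n *\<^sub>R (x n + x' n)))"
    using assms by (simp add: bounded_solution_def scaleR_add_right bounded_plus_comp)
  moreover have "x 0 + x' 0 - (y 0 + y' 0) \<in> Z"
    using assms subspace_add[of Z "x 0 - y 0" "x' 0 - y' 0"]
    by (simp add: bounded_solution_def algebra_simps)
  moreover have "x (Suc n) + x' (Suc n) - A n (x n + x' n) = y (Suc n) + y' (Suc n)" for n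
    using assms unfolding bounded_solution_def blinfun.add_right by (metis add_diff_add)
  ultimately show ?thesis by (simp add: bounded_solution_def)
qed

lemma bounded_solution_scaleR:
  assumes "subspace Z" "bounded_solution A a Z y x"
  shows "bounded_solution A a Z (\<lambda>n. c *\<^sub>R y n) (\<lambda>n. c *\<^sub>R x n)"
proof -
  have "bounded (range (\<lambda>n. a n *\<^sub>R c *\<^sub>R x n))"
    using assms(2) bounded_scaleR_comp[of "\<lambda>n. a n *\<^sub>R x n" UNIV c]
    by (simp add: bounded_solution_def mult.commute)
  then show ?thesis
    using assms subspace_scale[of Z "x 0 - y 0" c]
    by (simp add: bounded_solution_def blinfun.scaleR_right flip: scaleR_right_diff_distrib)
qed

lemma bounded_solution_limit:
  assumes "closed Z" and sols: "\<And>k. bounded_solution A a Z (Y k) (X k)"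
    and Y_lim: "\<And>n. (\<lambda>k. Y k n) \<longlonglongrightarrow> y n" and X_lim: "\<And>n. (\<lambda>k. X k n) \<longlonglongrightarrow> x n"
    and bounded: "bounded (range (\<lambda>n. a n *\<^sub>R x n))"
  shows "bounded_solution A a Z y x"
  unfolding bounded_solution_def
proof (intro conjI allI bounded)
  show "x 0 - y 0 \<in> Z"
    using sols by (intro closed_sequentially[OF \<open>closed Z\<close> _ tendsto_diff[OF X_lim Y_lim]])
      (simp add: bounded_solution_def)
  show "x (Suc n) - A n (x n) = y (Suc n)" for n
  proof (rule LIMSEQ_unique[OF _ Y_lim])
    have "(\<lambda>k. X k (Suc n) - A n (X k n)) \<longlonglongrightarrow> x (Suc n) - A n (x n)"
      by (intro tendsto_diff blinfun.tendsto tendsto_const X_lim)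
    then show "(\<lambda>k. Y k (Suc n)) \<longlonglongrightarrow> x (Suc n) - A n (x n)"
      using sols by (simp add: bounded_solution_def)
  qed
qed

lemma bounded_solution_weight_mono:
  assumes "bounded_solution A a Z y x" and "\<And>n. \<bar>b n\<bar> \<le> c * \<bar>a n\<bar>"
  shows "bounded_solution A b Z y x"
proof -
  obtain B where B: "\<And>n. \<bar>a n\<bar> * norm (x n) \<le> B"
    using assms(1) by (auto simp: bounded_solution_def bounded_iff)
  have "\<bar>b n\<bar> * norm (x n) \<le> \<bar>c\<bar> * B" for n
  proof -
    have "\<bar>b n\<bar> * norm (x n) \<le> \<bar>c\<bar> * \<bar>a n\<bar> * norm (x n)"
      using assms(2)[of n] abs_ge_self[of "c * \<bar>a n\<bar>"]
      by (intro mult_right_mono) (auto simp: abs_mult)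
    also have "\<dots> \<le> \<bar>c\<bar> * B"
      using B[of n] by (simp add: mult.assoc mult_left_mono)
    finally show ?thesis .
  qed
  then have "bounded (range (\<lambda>n. b n *\<^sub>R x n))"
    by (auto simp: bounded_iff)
  with assms(1) show ?thesis by (simp add: bounded_solution_def)
qed

lemma bounded_range_finite_change:
  assumes "bounded (range f)" "finite {n. f n \<noteq> g n}"
  shows "bounded (range g)"
proof (rule bounded_subset)
  show "bounded (range f \<union> g ` {n. f n \<noteq> g n})"
    using assms by (simp add: finite_imp_bounded)
  show "range g \<subseteq> range f \<union> g ` {n. f n \<noteq> g n}"
    by (auto simp: image_iff) metis
qed

locale weighted_admissibility =
  fixes A :: "nat \<Rightarrow> 'a::banach \<Rightarrow>\<^sub>L 'a" and a w :: "nat \<Rightarrow> real" and Z :: "'a set"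
  assumes a_pos: "\<And>n. 0 < a n"
    and w_pos: "\<And>n. 0 < w n"
    and subspace_Z: "subspace Z"
    and closed_Z: "closed Z"
    and ex1_bounded_solution_start_0:
      "\<And>y. y 0 = 0 \<Longrightarrow> summable (\<lambda>n. w n * norm (y n)) \<Longrightarrow> \<exists>!x. bounded_solution A a Z y x"
begin

lemma bounded_solution_unique:
  assumes "bounded_solution A a Z y x" "bounded_solution A a Z y x'"
  shows "x = x'"
proof -
  have "bounded_solution A a Z (\<lambda>n. y n + (-1) *\<^sub>R y n) (\<lambda>n. x n + (-1) *\<^sub>R x' n)"
    using assms subspace_Z by (intro bounded_solution_add bounded_solution_scaleR)
  then have "bounded_solution A a Z (\<lambda>_. 0) (\<lambda>n. x n - x' n)" by simp
  moreover have "bounded_solution A a Z (\<lambda>_. 0) (\<lambda>_. 0)"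
    by (simp add: bounded_solution_def subspace_0[OF subspace_Z] blinfun.zero_right)
  ultimately have "(\<lambda>n. x n - x' n) = (\<lambda>_. 0)"
    using ex1_bounded_solution_start_0[of "\<lambda>_. 0"] by auto
  then show ?thesis by (auto simp: fun_eq_iff)
qed

lemma ex_bounded_solution:
  assumes "summable (\<lambda>n. w n * norm (y n))"
  shows "\<exists>x. bounded_solution A a Z y x"
proof -
  \<comment> \<open>\<open>A 0\<close> carries the initial value \<open>y 0\<close> to time 1.\<close>
  define y' where "y' = y(0 := 0, 1 := y 1 + A 0 (y 0))"
  have "\<forall>\<^sub>F n in sequentially. w n * norm (y' n) = w n * norm (y n)"
    using eventually_gt_at_top[of 1] by eventually_elim (simp add: y'_def)
  from summable_cong[OF this] assms have "summable (\<lambda>n. w n * norm (y' n))" by simp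
  then obtain x' where x': "bounded_solution A a Z y' x'"
    using ex1_bounded_solution_start_0[of y'] by (auto simp: y'_def)
  define x where "x = x'(0 := x' 0 + y 0)"
  have "finite {n. a n *\<^sub>R x' n \<noteq> a n *\<^sub>R x n}"
    by (rule finite_subset[of _ "{0}"]) (auto simp: x_def)
  then have "bounded (range (\<lambda>n. a n *\<^sub>R x n))"
    using x' bounded_range_finite_change[of "\<lambda>n. a n *\<^sub>R x' n"] by (simp add: bounded_solution_def)
  moreover have "x 0 - y 0 \<in> Z"
    using x' by (simp add: bounded_solution_def x_def y'_def)
  moreover have "x (Suc n) - A n (x n) = y (Suc n)" for n
  proof -
    have "x' (Suc n) - A n (x' n) = y' (Suc n)"
      using x' by (simp add: bounded_solution_def)
    then show ?thesis
      by (cases n) (auto simp: x_def y'_def blinfun.add_right algebra_simps)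
  qed
  ultimately show ?thesis by (auto simp: bounded_solution_def)
qed

definition sol :: "(nat \<Rightarrow> 'a) \<Rightarrow> nat \<Rightarrow> 'a" where
  "sol y = (THE x. bounded_solution A a Z y x)"

lemma sol_eqI: "bounded_solution A a Z y x \<Longrightarrow> sol y = x"
  unfolding sol_def using bounded_solution_unique by blast

lemma bounded_solution_sol:
  "summable (\<lambda>n. w n * norm (y n)) \<Longrightarrow> bounded_solution A a Z y (sol y)"
  using ex_bounded_solution sol_eqI by metis

lemma sol_add:
  assumes "summable (\<lambda>n. w n * norm (y n))" "summable (\<lambda>n. w n * norm (y' n))"
  shows "sol (\<lambda>n. y n + y' n) = (\<lambda>n. sol y n + sol y' n)"
  by (intro sol_eqI bounded_solution_add subspace_Z bounded_solution_sol assms)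

lemma sol_scaleR:
  assumes "summable (\<lambda>n. w n * norm (y n))"
  shows "sol (\<lambda>n. c *\<^sub>R y n) = (\<lambda>n. c *\<^sub>R sol y n)"
  by (intro sol_eqI bounded_solution_scaleR subspace_Z bounded_solution_sol assms)

definition unweighted :: "'a l1 \<Rightarrow> nat \<Rightarrow> 'a" where
  "unweighted y n = l1_nth y n /\<^sub>R w n"

lemma summable_unweighted: "summable (\<lambda>n. w n * norm (unweighted y n))"
proof -
  have "w n * norm (unweighted y n) = norm (l1_nth y n)" for n
    using w_pos[of n] by (simp add: unweighted_def)
  then show ?thesis by (simp add: summable_norm_l1_nth)
qed

lemmas bounded_solution_sol_unweighted = bounded_solution_sol[OF summable_unweighted]

text \<open>The bounded sequences are the bounded continuous functions on the discrete space of the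
  natural numbers.\<close>

definition solution_operator :: "'a l1 \<Rightarrow> nat discrete \<Rightarrow>\<^sub>C 'a" where
  "solution_operator y =
    Bcontfun (\<lambda>i. a (of_discrete i) *\<^sub>R sol (unweighted y) (of_discrete i))"

lemma solution_operator_nth:
  "apply_bcontfun (solution_operator y) i =
    a (of_discrete i) *\<^sub>R sol (unweighted y) (of_discrete i)"
proof -
  have "bounded (range (\<lambda>n. a n *\<^sub>R sol (unweighted y) n))"
    using bounded_solution_sol_unweighted[of y] by (simp add: bounded_solution_def)
  then have "bounded (range (\<lambda>i. a (of_discrete i) *\<^sub>R sol (unweighted y) (of_discrete i)))"
    by (rule bounded_subset) auto
  moreover have "continuous_on UNIV (\<lambda>i. a (of_discrete i) *\<^sub>R sol (unweighted y) (of_discrete i))"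
    by (simp add: continuous_on_open_invariant open_discrete)
  ultimately show ?thesis
    by (simp add: solution_operator_def Bcontfun_inverse bcontfun_def)
qed

lemma linear_solution_operator: "linear solution_operator"
proof (rule linearI)
  fix y y' :: "'a l1" and c :: real
  have "unweighted (y + y') = (\<lambda>n. unweighted y n + unweighted y' n)"
    by (simp add: unweighted_def plus_l1.rep_eq scaleR_add_right fun_eq_iff)
  then show "solution_operator (y + y') = solution_operator y + solution_operator y'"
    by (intro bcontfun_eqI)
      (simp add: solution_operator_nth sol_add summable_unweighted scaleR_add_right)
  have "unweighted (c *\<^sub>R y) = (\<lambda>n. c *\<^sub>R unweighted y n)"
    by (simp add: unweighted_def scaleR_l1.rep_eq scaleR_left_commute fun_eq_iff)
  then show "solution_operator (c *\<^sub>R y) = c *\<^sub>R solution_operator y"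
    by (intro bcontfun_eqI)
      (simp add: solution_operator_nth sol_scaleR summable_unweighted scaleR_left_commute)
qed

lemma closed_graph_solution_operator:
  assumes Y_lim: "Y \<longlonglongrightarrow> y" and image_lim: "(\<lambda>k. solution_operator (Y k)) \<longlonglongrightarrow> f"
  shows "solution_operator y = f"
proof -
  define x where "x n = apply_bcontfun f (discrete n) /\<^sub>R a n" for n
  have rhs_lim: "(\<lambda>k. unweighted (Y k) n) \<longlonglongrightarrow> unweighted y n" for n
    unfolding unweighted_def
    by (intro tendsto_scaleR tendsto_const bounded_linear.tendsto[OF bounded_linear_l1_nth] Y_lim)
  have sol_lim: "(\<lambda>k. sol (unweighted (Y k)) n) \<longlonglongrightarrow> x n" for n
  proof -
    have "(\<lambda>k. apply_bcontfun (solution_operator (Y k)) (discrete n) /\<^sub>R a n) \<longlonglongrightarrow> x n"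
      unfolding x_def by (intro tendsto_scaleR tendsto_const
        tendsto_uniform_limitI[OF tendsto_bcontfun_uniform_limit[OF image_lim]]) simp
    then show ?thesis
      using a_pos[of n] by (simp add: solution_operator_nth discrete_inverse)
  qed
  have "bounded (range (\<lambda>n. apply_bcontfun f (discrete n)))"
    by (rule bounded_subset[OF bounded_apply_bcontfun]) auto
  then have "bounded (range (\<lambda>n. a n *\<^sub>R x n))"
    using a_pos by (simp add: x_def less_imp_neq[symmetric])
  then have "sol (unweighted y) = x"
    by (rule sol_eqI[OF bounded_solution_limit[OF closed_Z bounded_solution_sol_unweighted
      rhs_lim sol_lim]])
  then show ?thesis
    using a_pos by (intro bcontfun_eqI)
      (simp add: solution_operator_nth x_def of_discrete_inverse less_imp_neq[symmetric])
qed

theorem sol_bound: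
  "\<exists>C>0. \<forall>y m. summable (\<lambda>n. w n * norm (y n)) \<longrightarrow>
    a m * norm (sol y m) \<le> C * (\<Sum>n. w n * norm (y n))"
proof -
  have "bounded_linear solution_operator"
    by (rule closed_graph_theorem[OF linear_solution_operator closed_graph_solution_operator])
  then obtain C where "0 < C" and C: "\<And>y. norm (solution_operator y) \<le> norm y * C"
    using bounded_linear.pos_bounded by blast
  have "a m * norm (sol y m) \<le> C * (\<Sum>n. w n * norm (y n))"
    if y: "summable (\<lambda>n. w n * norm (y n))" for y m
  proof -
    define y' where "y' = Abs_l1 (\<lambda>n. w n *\<^sub>R y n)"
    have nth_y': "l1_nth y' = (\<lambda>n. w n *\<^sub>R y n)"
      using y w_pos by (simp add: y'_def Abs_l1_inverse less_imp_le)
    have "unweighted y' = y"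
      using w_pos by (simp add: unweighted_def nth_y' fun_eq_iff less_imp_neq[symmetric])
    then have "a m * norm (sol y m) = norm (apply_bcontfun (solution_operator y') (discrete m))"
      using a_pos[of m] by (simp add: solution_operator_nth discrete_inverse)
    also have "\<dots> \<le> norm y' * C"
      by (rule order_trans[OF norm_bounded C])
    also have "norm y' = (\<Sum>n. w n * norm (y n))"
      using w_pos by (simp add: norm_l1.rep_eq nth_y' less_imp_le)
    finally show ?thesis by (simp add: mult.commute)
  qed
  with \<open>0 < C\<close> show ?thesis by blast
qed

end

subsection \<open>The Green function and its dichotomy\<close>

lemma transition_homogeneous:
  fixes A :: "nat \<Rightarrow> 'a::real_normed_vector \<Rightarrow>\<^sub>L 'a"
  assumes "n \<le> m" "\<And>k. n \<le> k \<Longrightarrow> k < m \<Longrightarrow> x (Suc k) = A k (x k)"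
  shows "transition A m n (x n) = x m"
  using assms by (induction m rule: dec_induct) auto

definition impulse :: "nat \<Rightarrow> 'a \<Rightarrow> nat \<Rightarrow> 'a::zero" where
  "impulse n v k = (if k = n then v else 0)"

context weighted_admissibility
begin

definition green :: "nat \<Rightarrow> 'a \<Rightarrow> nat \<Rightarrow> 'a" where
  "green n v = sol (impulse n v)"

lemma sums_norm_impulse: "(\<lambda>k. w k * norm (impulse n v k)) sums (w n * norm v)"
  using sums_single[of n "\<lambda>k. w k * norm v"]
  by (rule sums_cong[THEN iffD1, rotated]) (simp add: impulse_def)

lemmas summable_impulse = sums_summable[OF sums_norm_impulse]

lemma bounded_solution_green: "bounded_solution A a Z (impulse n v) (green n v)"
  unfolding green_def by (rule bounded_solution_sol[OF summable_impulse])

lemma green_eqI: "bounded_solution A a Z (impulse n v) x \<Longrightarrow> green n v = x"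
  unfolding green_def by (rule sol_eqI)

lemma green_start: "green n v 0 - impulse n v 0 \<in> Z"
  using bounded_solution_green by (simp add: bounded_solution_def)

lemma green_step: "green n v (Suc k) = A k (green n v k) + impulse n v (Suc k)"
  using bounded_solution_green[of n v] by (simp add: bounded_solution_def algebra_simps)

lemma bounded_range_if_eventually_green:
  assumes "\<And>k. n < k \<Longrightarrow> x k = green n v k"
  shows "bounded (range (\<lambda>k. a k *\<^sub>R x k))"
proof (rule bounded_range_finite_change)
  show "bounded (range (\<lambda>k. a k *\<^sub>R green n v k))"
    using bounded_solution_green by (simp add: bounded_solution_def)
  have "{k. a k *\<^sub>R green n v k \<noteq> a k *\<^sub>R x k} \<subseteq> {..n}"
    by (auto intro!: leI simp: assms)
  then show "finite {k. a k *\<^sub>R green n v k \<noteq> a k *\<^sub>R x k}"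
    by (rule finite_subset) simp
qed

lemma linear_green: "linear (\<lambda>v. green n v k)"
proof (rule linearI)
  fix u v :: 'a and c :: real
  have "impulse n (u + v) = (\<lambda>k. impulse n u k + impulse n v k)"
    by (auto simp: impulse_def)
  then show "green n (u + v) k = green n u k + green n v k"
    by (simp only: green_def sol_add[OF summable_impulse summable_impulse])
  have "impulse n (c *\<^sub>R v) = (\<lambda>k. c *\<^sub>R impulse n v k)"
    by (auto simp: impulse_def)
  then show "green n (c *\<^sub>R v) k = c *\<^sub>R green n v k"
    by (simp only: green_def sol_scaleR[OF summable_impulse])
qed

lemma green_bound: "\<exists>C>0. \<forall>n v m. a m * norm (green n v m) \<le> C * (w n * norm v)"
proof -
  obtain C where "0 < C" and C: "\<And>y m. summable (\<lambda>k. w k * norm (y k)) \<Longrightarrow>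
      a m * norm (sol y m) \<le> C * (\<Sum>k. w k * norm (y k))"
    using sol_bound by blast
  then have "a m * norm (green n v m) \<le> C * (w n * norm v)" for n v m
    using C[OF summable_impulse] by (simp add: green_def flip: sums_unique[OF sums_norm_impulse])
  with \<open>0 < C\<close> show ?thesis by blast
qed

lemma bounded_linear_green: "bounded_linear (\<lambda>v. green n v k)"
proof -
  obtain C where C: "\<And>n v m. a m * norm (green n v m) \<le> C * (w n * norm v)"
    using green_bound by blast
  have "norm (green n v k) \<le> norm v * (C * w n / a k)" for v
    using C[of k n v] a_pos[of k] by (simp add: pos_le_divide_eq mult_ac)
  then show ?thesis
    by (intro bounded_linear.intro bounded_linear_axioms.intro linear_green) blast
qed

definition projection :: "nat \<Rightarrow> 'a \<Rightarrow>\<^sub>L 'a" where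
  "projection n = Blinfun (\<lambda>v. green n v n)"

lemma projection_apply: "projection n v = green n v n"
  unfolding projection_def by (simp only: bounded_linear_Blinfun_apply[OF bounded_linear_green])

text \<open>Up to time \<open>n\<close> this is the backward orbit, starting in \<open>Z\<close>, of the component of \<open>v\<close> in the
  kernel of \<open>projection n\<close>.\<close>

definition unstable_orbit :: "nat \<Rightarrow> 'a \<Rightarrow> nat \<Rightarrow> 'a" where
  "unstable_orbit n v k = impulse n v k - green n v k"

lemma unstable_orbit_start: "unstable_orbit n v 0 \<in> Z"
  using subspace_neg[OF subspace_Z green_start] by (simp add: unstable_orbit_def)

lemma unstable_orbit_step: "k < n \<Longrightarrow> unstable_orbit n v (Suc k) = A k (unstable_orbit n v k)"
  by (simp add: unstable_orbit_def green_step impulse_def blinfun.minus_right)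

lemma unstable_orbit_end: "unstable_orbit n v n = v - projection n v"
  by (simp add: unstable_orbit_def impulse_def projection_apply)

lemma bounded_linear_unstable_orbit: "bounded_linear (\<lambda>v. unstable_orbit n v k)"
  unfolding unstable_orbit_def
proof (rule bounded_linear_sub[OF _ bounded_linear_green])
  show "bounded_linear (\<lambda>v. impulse n v k :: 'a)"
    by (cases "k = n") (simp_all add: impulse_def bounded_linear_ident bounded_linear_zero)
qed

lemma transition_green: "n \<le> m \<Longrightarrow> transition A m n (green n v n) = green n v m"
  by (rule transition_homogeneous[where x = "green n v"]) (simp_all add: green_step impulse_def)

lemma transition_unstable_orbit:
  "m \<le> n \<Longrightarrow> transition A n m (unstable_orbit n v m) = v - projection n v"
  unfolding unstable_orbit_end[symmetric]
  by (rule transition_homogeneous[where x = "unstable_orbit n v"])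
    (simp_all add: unstable_orbit_step)

lemma green_Suc_A: "green (Suc n) (A n v) k = green n v k - impulse n v k"
proof -
  have "green (Suc n) (A n v) = (\<lambda>k. green n v k - impulse n v k)"
  proof (rule green_eqI, unfold bounded_solution_def, intro conjI allI)
    show "bounded (range (\<lambda>k. a k *\<^sub>R (green n v k - impulse n v k)))"
      by (rule bounded_range_if_eventually_green[of n _ v]) (simp add: impulse_def)
    show "green n v 0 - impulse n v 0 - impulse (Suc n) (A n v) 0 \<in> Z"
      using green_start[of n v] by (simp add: impulse_def[of "Suc n"])
    show "green n v (Suc k) - impulse n v (Suc k) - A k (green n v k - impulse n v k)
        = impulse (Suc n) (A n v) (Suc k)" for k
      by (simp add: green_step blinfun.diff_right) (simp add: impulse_def blinfun.zero_right)
  qed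
  then show ?thesis by simp
qed

lemma projection_Suc_A: "projection (Suc n) (A n v) = A n (projection n v)"
  by (simp only: projection_apply green_Suc_A) (simp add: green_step impulse_def)

lemma projection_idem: "projection n (projection n v) = projection n v"
proof -
  define x where "x k = (if k < n then 0 else green n v k)" for k
  have "green n (green n v n) = x"
  proof (rule green_eqI, unfold bounded_solution_def, intro conjI allI)
    show "bounded (range (\<lambda>k. a k *\<^sub>R x k))"
      by (rule bounded_range_if_eventually_green[of n _ v]) (simp add: x_def)
    show "x 0 - impulse n (green n v n) 0 \<in> Z"
      by (simp add: x_def impulse_def subspace_0[OF subspace_Z])
    show "x (Suc k) - A k (x k) = impulse n (green n v n) (Suc k)" for k
      by (cases "Suc k" n rule: linorder_cases)
        (auto simp: x_def impulse_def green_step blinfun.zero_right)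
  qed
  then show ?thesis by (simp add: projection_apply x_def)
qed

lemma projection_eq_0_if_orbit_from_Z:
  assumes "z 0 \<in> Z" "\<And>k. k < n \<Longrightarrow> z (Suc k) = A k (z k)"
  shows "projection n (z n) = 0"
proof -
  define x where "x k = (if k < n then - z k else 0)" for k
  have "green n (z n) = x"
  proof (rule green_eqI, unfold bounded_solution_def, intro conjI allI)
    show "bounded (range (\<lambda>k. a k *\<^sub>R x k))"
      by (rule bounded_range_finite_change[of "\<lambda>_. 0"]) (auto simp: x_def)
    show "x 0 - impulse n (z n) 0 \<in> Z"
      using assms(1) subspace_neg[OF subspace_Z] by (simp add: x_def impulse_def)
    show "x (Suc k) - A k (x k) = impulse n (z n) (Suc k)" for k
      using assms(2)[of k]
      by (cases "Suc k" n rule: linorder_cases) (auto simp: x_def impulse_def blinfun.minus_right)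
  qed
  then show ?thesis by (simp add: projection_apply x_def)
qed

lemma unstable_orbit_in_kernel:
  "m \<le> n \<Longrightarrow> unstable_orbit n v m \<in> ker_blinfun (projection m)"
  unfolding ker_blinfun_def mem_Collect_eq
  by (rule projection_eq_0_if_orbit_from_Z[where z = "unstable_orbit n v"])
    (simp_all add: unstable_orbit_start unstable_orbit_step)

lemma unstable_orbit_transition:
  assumes "m \<le> n"
  shows "unstable_orbit n (transition A n m v) m = v - projection m v"
  using assms
proof (induction n rule: dec_induct)
  case base
  show ?case by (simp add: unstable_orbit_end)
next
  case (step n)
  then show ?case by (simp add: unstable_orbit_def green_Suc_A impulse_def[of "Suc n"])
qed

lemma bij_betw_kernel:
  "bij_betw (A n) (ker_blinfun (projection n)) (ker_blinfun (projection (Suc n)))"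
proof (rule bij_betw_byWitness[where f' = "\<lambda>v. unstable_orbit (Suc n) v n"])
  show "\<forall>v\<in>ker_blinfun (projection n). unstable_orbit (Suc n) (A n v) n = v"
    using unstable_orbit_transition[of n "Suc n"] by (simp add: ker_blinfun_def)
  show "\<forall>v\<in>ker_blinfun (projection (Suc n)). A n (unstable_orbit (Suc n) v n) = v"
    using transition_unstable_orbit[of n "Suc n"] by (simp add: ker_blinfun_def)
  show "A n ` ker_blinfun (projection n) \<subseteq> ker_blinfun (projection (Suc n))"
    using projection_Suc_A by (auto simp: ker_blinfun_def blinfun.zero_right)
  show "(\<lambda>v. unstable_orbit (Suc n) v n) ` ker_blinfun (projection (Suc n))
      \<subseteq> ker_blinfun (projection n)"
    using unstable_orbit_in_kernel by auto
qed

lemma inj_on_transition_kernel: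
  "m \<le> n \<Longrightarrow> inj_on (transition A n m) (ker_blinfun (projection m))"
  by (rule inj_on_inverseI[of _ "\<lambda>v. unstable_orbit n v m"])
    (simp add: unstable_orbit_transition ker_blinfun_def)

lemma backward_transition_projection:
  assumes "m \<le> n"
  shows "backward_transition A projection m n (v - projection n v) = unstable_orbit n v m"
  unfolding backward_transition_def
  by (rule inv_into_f_eq[OF inj_on_transition_kernel])
    (simp_all add: assms unstable_orbit_in_kernel transition_unstable_orbit)

theorem dichotomyI:
  assumes "0 < D" "0 < \<alpha>" and \<nu>_nonneg: "\<And>n. 0 \<le> \<nu> n"
    and forward: "\<And>m n v. n \<le> m \<Longrightarrow>
      norm (green n v m) \<le> D * \<nu> n * (\<mu> m / \<mu> n) powr (- \<alpha>) * norm v"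
    and backward: "\<And>m n v. m \<le> n \<Longrightarrow>
      norm (unstable_orbit n v m) \<le> D * \<nu> n * (\<mu> n / \<mu> m) powr (- \<alpha>) * norm v"
  shows "dichotomy \<mu> \<nu> A"
proof -
  have const_nonneg: "0 \<le> D * \<nu> n * r powr (- \<alpha>)" for n r
    using \<open>0 < D\<close> \<nu>_nonneg[of n] by simp
  have forward_norm: "norm (transition A m n o\<^sub>L projection n) \<le> D * \<nu> n * (\<mu> m / \<mu> n) powr (- \<alpha>)"
    if "n \<le> m" for m n
    using that by (intro norm_blinfun_bound const_nonneg)
      (simp add: projection_apply transition_green forward)
  have backward_norm:
    "bounded_linear (\<lambda>v. backward_transition A projection m n (v - projection n v)) \<and>
      onorm (\<lambda>v. backward_transition A projection m n (v - projection n v))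
        \<le> D * \<nu> n * (\<mu> n / \<mu> m) powr (- \<alpha>)"
    if "m \<le> n" for m n
    using backward[OF that]
    by (simp add: backward_transition_projection[OF that] bounded_linear_unstable_orbit
      onorm_bound const_nonneg)
  show ?thesis
    unfolding dichotomy_def
  proof (rule exI[of _ projection], intro conjI allI bij_betw_kernel)
    show "projection n o\<^sub>L projection n = projection n" for n
      by (rule blinfun_eqI) (simp add: projection_idem)
    show "A n o\<^sub>L projection n = projection (Suc n) o\<^sub>L A n" for n
      by (rule blinfun_eqI) (simp add: projection_Suc_A)
  qed (use \<open>0 < D\<close> \<open>0 < \<alpha>\<close> forward_norm backward_norm in blast)
qed

end

subsection \<open>Two weights\<close>

lemma le_powr_ratio_if_weighted_le:
  fixes p q s t :: real
  assumes "0 < p" "0 < q" "p powr s * t \<le> C * (q powr s * b * c)"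
  shows "t \<le> C * b * (p / q) powr (- s) * c"
  using assms by (simp add: powr_divide powr_minus field_simps)

locale two_weight_admissibility =
  stable: weighted_admissibility A "\<lambda>n. \<mu> n powr \<beta>" "\<lambda>n. \<mu> n powr \<beta> * \<nu> n" Z +
  unstable: weighted_admissibility A "\<lambda>n. \<mu> n powr (- \<beta>)" "\<lambda>n. \<mu> n powr (- \<beta>) * \<nu> n" Z
  for A :: "nat \<Rightarrow> 'a::banach \<Rightarrow>\<^sub>L 'a" and \<mu> \<nu> :: "nat \<Rightarrow> real" and \<beta> :: real and Z :: "'a set" +
  assumes mono_\<mu>: "mono \<mu>" and \<mu>_pos: "\<And>n. 0 < \<mu> n" and \<nu>_ge_1: "\<And>n. 1 \<le> \<nu> n" and \<beta>_pos: "0 < \<beta>"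
begin

lemma unstable_weight_le: "\<bar>\<mu> k powr (- \<beta>)\<bar> \<le> \<mu> 0 powr (- 2 * \<beta>) * \<bar>\<mu> k powr \<beta>\<bar>"
proof -
  have "\<mu> k powr (- \<beta>) = \<mu> k powr (- 2 * \<beta>) * \<mu> k powr \<beta>"
    by (simp flip: powr_add)
  also have "\<dots> \<le> \<mu> 0 powr (- 2 * \<beta>) * \<mu> k powr \<beta>"
    using \<mu>_pos[of 0] \<beta>_pos monoD[OF mono_\<mu>, of 0 k]
    by (intro mult_right_mono powr_mono2') auto
  finally show ?thesis by simp
qed

lemma green_unstable_eq_stable: "unstable.green = stable.green"
proof (intro ext)
  fix n v k
  have "bounded_solution A (\<lambda>k. \<mu> k powr (- \<beta>)) Z (impulse n v) (stable.green n v)"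
    by (rule bounded_solution_weight_mono[OF stable.bounded_solution_green unstable_weight_le])
  then show "unstable.green n v k = stable.green n v k"
    by (simp only: unstable.green_eqI)
qed

lemma green_forward_bound:
  "\<exists>C>0. \<forall>n v m. norm (stable.green n v m) \<le> C * \<nu> n * (\<mu> m / \<mu> n) powr (- \<beta>) * norm v"
proof -
  obtain C where "0 < C" and C: "\<And>n v m. \<mu> m powr \<beta> * norm (stable.green n v m)
      \<le> C * (\<mu> n powr \<beta> * \<nu> n * norm v)"
    using stable.green_bound by blast
  with le_powr_ratio_if_weighted_le[OF \<mu>_pos \<mu>_pos C] show ?thesis by blast
qed

lemma green_backward_bound:
  "\<exists>C>0. \<forall>n v m. norm (stable.green n v m) \<le> C * \<nu> n * (\<mu> n / \<mu> m) powr (- \<beta>) * norm v"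
proof -
  have powr_swap: "(\<mu> m / \<mu> n) powr (- (- \<beta>)) = (\<mu> n / \<mu> m) powr (- \<beta>)" for m n
    using \<mu>_pos[of m] \<mu>_pos[of n] by (simp add: powr_divide powr_minus field_simps)
  obtain C where "0 < C" and C: "\<And>n v m. \<mu> m powr (- \<beta>) * norm (stable.green n v m)
      \<le> C * (\<mu> n powr (- \<beta>) * \<nu> n * norm v)"
    using unstable.green_bound unfolding green_unstable_eq_stable by blast
  with le_powr_ratio_if_weighted_le[OF \<mu>_pos \<mu>_pos C, unfolded powr_swap] show ?thesis by blast
qed

lemma unstable_orbit_bound:
  "\<exists>C>0. \<forall>n v m. norm (stable.unstable_orbit n v m)
    \<le> C * \<nu> n * (\<mu> n / \<mu> m) powr (- \<beta>) * norm v"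
proof -
  obtain C where "0 < C" and C: "\<And>n v m. norm (stable.green n v m)
      \<le> C * \<nu> n * (\<mu> n / \<mu> m) powr (- \<beta>) * norm v"
    using green_backward_bound by blast
  have "norm (stable.unstable_orbit n v m) \<le> (1 + C) * \<nu> n * (\<mu> n / \<mu> m) powr (- \<beta>) * norm v"
    for n v m
  proof -
    have "norm (impulse n v m) \<le> \<nu> n * (\<mu> n / \<mu> m) powr (- \<beta>) * norm v"
      using mult_right_mono[OF \<nu>_ge_1[of n], of "norm v"] \<mu>_pos[of n] \<nu>_ge_1[of n]
      by (simp add: impulse_def)
    moreover have "norm (stable.unstable_orbit n v m)
        \<le> norm (impulse n v m) + norm (stable.green n v m)"
      unfolding stable.unstable_orbit_def by (rule norm_triangle_ineq4)
    ultimately show ?thesis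
      using C[of n v m] by (simp add: distrib_right)
  qed
  with \<open>0 < C\<close> show ?thesis by (intro exI[of _ "1 + C"]) simp
qed

theorem admits_dichotomy: "dichotomy \<mu> \<nu> A"
proof -
  obtain B where B: "0 < B" "\<And>n v m. norm (stable.green n v m)
      \<le> B * \<nu> n * (\<mu> m / \<mu> n) powr (- \<beta>) * norm v"
    using green_forward_bound by blast
  obtain C where C: "0 < C" "\<And>n v m. norm (stable.unstable_orbit n v m)
      \<le> C * \<nu> n * (\<mu> n / \<mu> m) powr (- \<beta>) * norm v"
    using unstable_orbit_bound by blast
  have \<nu>_nonneg: "0 \<le> \<nu> n" for n
    using \<nu>_ge_1[of n] by simp
  have enlarge: "t \<le> (B + C) * \<nu> n * p powr (- \<beta>) * norm v"
    if "t \<le> K * \<nu> n * p powr (- \<beta>) * norm v" "K \<le> B + C" for t K n p and v :: 'a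
    using that(1) mult_right_mono[OF that(2), of "\<nu> n * p powr (- \<beta>) * norm v"] \<nu>_nonneg[of n]
    by (simp add: mult.assoc)
  show ?thesis
  proof (rule stable.dichotomyI[OF _ \<beta>_pos \<nu>_nonneg])
    show "0 < B + C" using B C by simp
    show "norm (stable.green n v m) \<le> (B + C) * \<nu> n * (\<mu> m / \<mu> n) powr (- \<beta>) * norm v"
      for m n v by (rule enlarge[OF B(2)]) (use C in simp)
    show "norm (stable.unstable_orbit n v m) \<le> (B + C) * \<nu> n * (\<mu> n / \<mu> m) powr (- \<beta>) * norm v"
      for m n v by (rule enlarge[OF C(2)]) (use B in simp)
  qed
qed

end

lemma bounded_solution_iff_linf_weighted_init:
  assumes "y 0 = 0"
  shows "bounded_solution A (\<lambda>n. \<mu> n powr \<gamma>) Z y x \<longleftrightarrow>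
    x \<in> linf_weighted_init \<mu> \<gamma> Z \<and> (\<forall>n. x (Suc n) - A n (x n) = y (Suc n))"
proof -
  have "bounded (range (\<lambda>n. \<mu> n powr \<gamma> *\<^sub>R x n)) \<longleftrightarrow> bdd_above (range (\<lambda>n. \<mu> n powr \<gamma> * norm (x n)))"
    by (simp add: bounded_iff bdd_above_def)
  then show ?thesis
    using assms by (simp add: bounded_solution_def linf_weighted_init_def linf_weighted_def)
qed

theorem theorem3p2:
  fixes A :: "nat \<Rightarrow> 'a::banach \<Rightarrow>\<^sub>L 'a"
    and \<mu> \<nu> :: "nat \<Rightarrow> real"
  assumes "growth_rate \<mu>"
    and "\<And>n. 1 \<le> \<nu> n"
    and "\<exists>(Z :: 'a set) (\<beta> :: real). subspace Z \<and> closed Z \<and> 0 < \<beta> \<and>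
      (\<forall>y \<in> l1_weighted_0 \<mu> \<nu> \<beta>. \<exists>!x. x \<in> linf_weighted_init \<mu> \<beta> Z \<and>
         (\<forall>n. x (Suc n) - A n (x n) = y (Suc n))) \<and>
      (\<forall>y \<in> l1_weighted_0 \<mu> \<nu> (- \<beta>). \<exists>!x. x \<in> linf_weighted_init \<mu> (- \<beta>) Z \<and>
         (\<forall>n. x (Suc n) - A n (x n) = y (Suc n)))"
  shows "dichotomy \<mu> \<nu> A"
proof -
  obtain Z \<beta> where Z: "subspace Z" "closed Z" and "0 < \<beta>"
    and ex1: "\<And>\<gamma> y. \<gamma> \<in> {\<beta>, - \<beta>} \<Longrightarrow> y \<in> l1_weighted_0 \<mu> \<nu> \<gamma> \<Longrightarrow>
      \<exists>!x. x \<in> linf_weighted_init \<mu> \<gamma> Z \<and> (\<forall>n. x (Suc n) - A n (x n) = y (Suc n))"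
    using assms(3) by (metis insertE singletonD)
  have \<mu>: "mono \<mu>" "\<And>n. 0 < \<mu> n"
    using assms(1) by (auto simp: growth_rate_def strict_mono_mono)
  have "0 < \<nu> n" for n
    using assms(2)[of n] by simp
  then have "weighted_admissibility A (\<lambda>n. \<mu> n powr \<gamma>) (\<lambda>n. \<mu> n powr \<gamma> * \<nu> n) Z"
    if "\<gamma> \<in> {\<beta>, - \<beta>}" for \<gamma>
    using Z \<mu>(2) ex1[OF that]
    by unfold_locales (simp_all add: bounded_solution_iff_linf_weighted_init
      l1_weighted_0_def l1_weighted_def less_imp_neq[symmetric])
  then have "two_weight_admissibility A \<mu> \<nu> \<beta> Z"
    using \<mu> assms(2) \<open>0 < \<beta>\<close>
    by (intro two_weight_admissibility.intro two_weight_admissibility_axioms.intro) simp_all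
  then show ?thesis by (rule two_weight_admissibility.admits_dichotomy)
qed

end
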